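(* Let $(f_s)_{s=1,\dots,N}$ be any finite sequence of increasing maps $f_s:\mathbb N\to\mathbb N$ with $f_s(1)>1$. Then the collection $\mathcal A_{ld}$ of subsets of $\mathbb N$ with positive lower density is $(f_s)_{s=1}^N$-weakly partition regular: for any sequence $(B_j)_{j\geq1}\subset\mathcal A_{ld}$ there exists a sequence $(A_j)_{j\geq1}\subset\mathcal A_{ld}$ such that, for every $j,l\geq1$, $A_j\subset B_j$ and $$f_s^m(\{1,\dots,j\})\cap f_t^n(\{1,\dots,l\})=\varnothing$$ for all $m\in A_j$, all $n\in A_l$ with $m\neq n$, and all $s,t\in\{1,\dots,N\}$.
   Context: $\mathbb N=\{1,2,\dots\}$; "increasing" means strictly increasing; $f^m$ denotes the $m$-th iterate of $f$. The lower density of $A\subset\mathbb N$ is $\liminf_{n\to\infty}\frac1n\#(A\cap[1,n])$. *)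

theory Defs
  imports Complex_Main "HOL-Library.Liminf_Limsup" "HOL-Library.Extended_Real"
begin

text \<open>
  The positive integers are the set \<open>{1..}\<close> of natural numbers; values of maps at 0 and
  members of sequences with index 0 are never constrained or used. The lower density is
  taken in the extended reals, where the limit inferior of any sequence exists. The junk
  value at \<open>n = 0\<close> (division by 0) does not affect it.
\<close>

definition lower_density :: "nat set \<Rightarrow> ereal" where
  "lower_density A = liminf (\<lambda>n. ereal (real (card (A \<inter> {1..n})) / real n))"

definition pos_lower_density_sets :: "nat set set" where
  "pos_lower_density_sets = {A. A \<subseteq> {1..} \<and> lower_density A > 0}"

definition weakly_partition_regular ::
    "nat \<Rightarrow> (nat \<Rightarrow> nat \<Rightarrow> nat) \<Rightarrow> nat set set \<Rightarrow> bool" where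
  "weakly_partition_regular N f \<A> \<longleftrightarrow>
     (\<forall>B :: nat \<Rightarrow> nat set. (\<forall>j\<ge>1. B j \<in> \<A>) \<longrightarrow>
        (\<exists>A :: nat \<Rightarrow> nat set. (\<forall>j\<ge>1. A j \<in> \<A>) \<and>
           (\<forall>j\<ge>1. \<forall>l\<ge>1. A j \<subseteq> B j \<and>
              (\<forall>m\<in>A j. \<forall>n\<in>A l. m \<noteq> n \<longrightarrow>
                 (\<forall>s\<in>{1..N}. \<forall>t\<in>{1..N}.
                    (f s ^^ m) ` {1..j} \<inter> (f t ^^ n) ` {1..l} = {})))))"

end

theory Submission imports Defs begin

text \<open>
  For fixed \<open>s\<close>, \<open>t\<close>, \<open>a\<close>, \<open>b\<close> the pairs \<open>(m, n)\<close> with \<open>f\<^sub>s\<^sup>m(a) = f\<^sub>t\<^sup>n(b)\<close> form the graph of a strictly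
  increasing partial map, because the orbits are strictly increasing. Suppose such a map sends
  \<open>D\<close> to \<open>\<nat>\<close>. Keeping only every \<open>K\<close>-th element of \<open>D\<close> costs a factor \<open>K\<close> in density, while the
  image of what remains has at most \<open>x / K\<close> elements up to \<open>x\<close>, for every \<open>x\<close>. So one can choose
  successively \<open>C\<^sub>l \<subseteq> B\<^sub>l\<close> of positive lower density whose conflict partners have a density that is
  uniformly tiny compared with the densities of all earlier \<open>C\<^sub>i\<close>; removing from \<open>C\<^sub>i\<close> the partners
  of all \<open>C\<^sub>l\<close> with \<open>l > i\<close> keeps its lower density positive. Conflicts inside one level are
  removed by greedy selection, as each number has boundedly many partners.
\<close>

section \<open>Linear growth\<close>

text \<open>An explicit constant replaces the limit inferior: thinning and removal become
  inequalities between constants, and a later set can be chosen against the constant of an earlier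
  one.\<close>

definition linear_growth :: "real \<Rightarrow> nat set \<Rightarrow> bool" where
  "linear_growth c A \<longleftrightarrow> c > 0 \<and> (\<forall>\<^sub>F x in sequentially. c * real x \<le> real (card (A \<inter> {1..x})))"

lemma pos_lower_density_iff:
  "A \<in> pos_lower_density_sets \<longleftrightarrow> A \<subseteq> {1..} \<and> (\<exists>c. linear_growth c A)"
proof -
  let ?q = "\<lambda>n. ereal (real (card (A \<inter> {1..n})) / real n)"
  have "lower_density A > 0 \<longleftrightarrow> (\<exists>c. linear_growth c A)"
  proof
    assume "lower_density A > 0"
    then obtain c where c: "0 < ereal c" "ereal c < lower_density A"
      using ereal_dense2 by blast
    have lt: "\<forall>\<^sub>F n in sequentially. ereal c < ?q n"
      using less_LiminfD[OF c(2)[unfolded lower_density_def]] .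
    have "\<forall>\<^sub>F n in sequentially. c * real n \<le> real (card (A \<inter> {1..n}))"
      using lt eventually_gt_at_top[of 0] by eventually_elim (simp add: field_simps)
    then show "\<exists>c. linear_growth c A" using c unfolding linear_growth_def by auto
  next
    assume "\<exists>c. linear_growth c A"
    then obtain c where c: "c > 0"
      and ev: "\<forall>\<^sub>F n in sequentially. c * real n \<le> real (card (A \<inter> {1..n}))"
      unfolding linear_growth_def by auto
    have "\<forall>\<^sub>F n in sequentially. ereal c \<le> ?q n"
      using ev eventually_gt_at_top[of 0] by eventually_elim (simp add: field_simps)
    then have "ereal c \<le> lower_density A"
      unfolding lower_density_def by (rule Liminf_bounded)
    then show "lower_density A > 0" using c by (metis ereal_less(2) less_le_trans)
  qed
  then show ?thesis unfolding pos_lower_density_sets_def by simp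
qed

lemma linear_growth_mono:
  assumes "linear_growth c A" "0 < c'" "c' \<le> c"
  shows "linear_growth c' A"
  unfolding linear_growth_def
proof
  have "\<forall>\<^sub>F x in sequentially. c * real x \<le> real (card (A \<inter> {1..x}))"
    using assms(1) unfolding linear_growth_def by simp
  then show "\<forall>\<^sub>F x in sequentially. c' * real x \<le> real (card (A \<inter> {1..x}))"
    by eventually_elim (meson assms(3) mult_right_mono of_nat_0_le_iff order_trans)
qed (fact assms(2))

text \<open>Once \<open>x\<close> is at least \<open>2 * L / c\<close>, the additive error takes at
  most half of \<open>c * x\<close>; this is the factor 2 in the new constant. It serves every
  selection that keeps a fixed fraction up to rounding.\<close>

lemma linear_growth_of_card_le:
  assumes A: "linear_growth c A" and K: "K > 0"
    and le: "\<And>x. card (A \<inter> {1..x}) \<le> K * card (T \<inter> {1..x}) + L"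
  shows "\<exists>c'. linear_growth c' T"
proof (intro exI)
  have c: "c > 0" and ev: "\<forall>\<^sub>F x in sequentially. c * real x \<le> real (card (A \<inter> {1..x}))"
    using A unfolding linear_growth_def by auto
  have "\<forall>\<^sub>F x in sequentially. real x \<ge> 2 * real L / c"
    using filterlim_real_sequentially by (simp add: filterlim_at_top)
  with ev have "\<forall>\<^sub>F x in sequentially. c / (2 * real K) * real x \<le> real (card (T \<inter> {1..x}))"
  proof eventually_elim
    case (elim x)
    have "real (card (A \<inter> {1..x})) \<le> real K * real (card (T \<inter> {1..x})) + real L"
      using le[of x] by (metis of_nat_add of_nat_le_iff of_nat_mult)
    then have "c * real x \<le> 2 * (real K * real (card (T \<inter> {1..x})))"
      using elim c by (simp add: field_simps)
    then show ?case using K by (simp add: field_simps)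
  qed
  then show "linear_growth (c / (2 * real K)) T"
    unfolding linear_growth_def using c K by simp
qed

lemma linear_growth_Diff:
  assumes A: "linear_growth e A"
    and M: "\<And>x. real (card (M \<inter> {1..x})) \<le> e / 2 * real x"
  shows "linear_growth (e / 2) (A - M)"
  unfolding linear_growth_def
proof
  have "\<forall>\<^sub>F x in sequentially. e * real x \<le> real (card (A \<inter> {1..x}))"
    using A unfolding linear_growth_def by simp
  then show "\<forall>\<^sub>F x in sequentially. e / 2 * real x \<le> real (card ((A - M) \<inter> {1..x}))"
  proof eventually_elim
    case (elim x)
    have "card (A \<inter> {1..x}) \<le> card ((A - M) \<inter> {1..x} \<union> M \<inter> {1..x})"
      by (rule card_mono) auto
    also have "\<dots> \<le> card ((A - M) \<inter> {1..x}) + card (M \<inter> {1..x})"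
      by (rule card_Un_le)
    finally show ?case using elim M[of x] by (simp add: field_simps)
  qed
qed (use A in \<open>simp add: linear_growth_def\<close>)

section \<open>Thinning along comonotone relations\<close>

text \<open>The one equivalence, read for both orders of two pairs, makes \<open>R\<close>
  single-valued, injective and increasing: the graph of a strictly increasing partial map.\<close>

definition comonotone :: "(nat \<Rightarrow> nat \<Rightarrow> bool) \<Rightarrow> bool" where
  "comonotone R \<longleftrightarrow> (\<forall>m n m' n'. R m n \<longrightarrow> R m' n' \<longrightarrow> (m < m' \<longleftrightarrow> n < n'))"

lemma comonotone_less_iff:
  "comonotone R \<Longrightarrow> R m n \<Longrightarrow> R m' n' \<Longrightarrow> m < m' \<longleftrightarrow> n < n'"
  unfolding comonotone_def by blast

lemma comonotone_eq_iff:
  assumes "comonotone R" "R m n" "R m' n'"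
  shows "m = m' \<longleftrightarrow> n = n'"
  using comonotone_less_iff[OF assms] comonotone_less_iff[OF assms(1,3,2)]
  by (metis linorder_neq_iff)

text \<open>Preimages rather than images: in a conflict pair the first entry will lie in the earlier
  set, and that is the set from which partners are removed.\<close>

definition partners :: "(nat \<Rightarrow> nat \<Rightarrow> bool) \<Rightarrow> nat set \<Rightarrow> nat set" where
  "partners R T = {m. \<exists>n\<in>T. R m n}"

lemma partners_mono: "S \<subseteq> T \<Longrightarrow> partners R S \<subseteq> partners R T"
  unfolding partners_def by blast

text \<open>For positive \<open>n\<close> in \<open>D\<close>,
  \<open>card (D \<inter> {1..n})\<close> is the rank of \<open>n\<close>, so the count grows
  exactly when the rank reaches a multiple of \<open>K\<close>. Exact rounding down later gives
  bounds without additive error.\<close>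

lemma card_every_Kth:
  fixes D :: "nat set"
  assumes "K > 0"
  shows "card ({n \<in> D. K dvd card (D \<inter> {1..n})} \<inter> {1..x}) = card (D \<inter> {1..x}) div K"
proof (induction x)
  case 0
  then show ?case by simp
next
  case (Suc x)
  let ?T = "{n \<in> D. K dvd card (D \<inter> {1..n})}"
  have ins: "X \<inter> {1..Suc x} = (if Suc x \<in> X then insert (Suc x) (X \<inter> {1..x}) else X \<inter> {1..x})"
    for X :: "nat set" by (auto simp: le_Suc_eq)
  show ?case
  proof (cases "Suc x \<in> D")
    case True
    then have D: "card (D \<inter> {1..Suc x}) = Suc (card (D \<inter> {1..x}))"
      by (subst ins) simp
    have "Suc x \<in> ?T \<longleftrightarrow> K dvd Suc (card (D \<inter> {1..x}))"
      using True D by simp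
    then have "card (?T \<inter> {1..Suc x}) =
        (if K dvd Suc (card (D \<inter> {1..x})) then Suc (card (?T \<inter> {1..x})) else card (?T \<inter> {1..x}))"
      by (subst ins) simp
    then show ?thesis using Suc.IH D by (auto simp: div_Suc dvd_eq_mod_eq_0)
  next
    case False
    then have "?T \<inter> {1..Suc x} = ?T \<inter> {1..x}" "D \<inter> {1..Suc x} = D \<inter> {1..x}"
      using ins[of ?T] ins[of D] by auto
    then show ?thesis using Suc.IH by simp
  qed
qed

text \<open>Let \<open>m\<close> be the largest partner up to \<open>x\<close> and \<open>n\<close>
  its mate in \<open>T\<close>. The partners up to \<open>x\<close> inject into the kept elements up
  to \<open>n\<close>, which are at most a \<open>K\<close>-th of \<open>D \<inter> {1..n}\<close>,
  and that set injects back into \<open>{1..x}\<close>. Hence the bound holds at every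
  \<open>x\<close>, not just eventually.\<close>

lemma thin_comonotone:
  assumes R: "comonotone R" and K: "K > 0"
    and B: "B \<subseteq> {1..}" "linear_growth c B"
  shows "\<exists>T\<subseteq>B. (\<exists>c'. linear_growth c' T) \<and> (\<forall>x. K * card (partners R T \<inter> {1..x}) \<le> x)"
proof -
  \<comment> \<open>Elements without a positive partner add nothing to the counts of partners, so
    only \<open>D\<close> is thinned.\<close>
  define D where "D = {n \<in> B. \<exists>m\<ge>1. R m n}"
  define E where "E = {n \<in> D. K dvd card (D \<inter> {1..n})}"
  define T where "T = (B - D) \<union> E"
  have TB: "T \<subseteq> B" unfolding T_def E_def D_def by auto
  have E: "card (E \<inter> {1..x}) = card (D \<inter> {1..x}) div K" for x
    unfolding E_def by (rule card_every_Kth[OF K])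
  have "card (B \<inter> {1..x}) \<le> K * card (T \<inter> {1..x}) + K" for x
  proof -
    have "B \<inter> {1..x} = (B - D) \<inter> {1..x} \<union> D \<inter> {1..x}"
      unfolding D_def by auto
    then have "card (B \<inter> {1..x}) \<le> card ((B - D) \<inter> {1..x}) + card (D \<inter> {1..x})"
      by (metis card_Un_le)
    also have "card (D \<inter> {1..x}) \<le> K * card (E \<inter> {1..x}) + K"
      unfolding E using K
      by (metis add_left_mono mod_less_divisor less_imp_le mult_div_mod_eq)
    also have "card ((B - D) \<inter> {1..x}) \<le> K * card ((B - D) \<inter> {1..x})"
      using K by simp
    finally have "card (B \<inter> {1..x}) \<le> K * (card ((B - D) \<inter> {1..x}) + card (E \<inter> {1..x})) + K"
      by (simp add: algebra_simps)
    also have "card ((B - D) \<inter> {1..x}) + card (E \<inter> {1..x}) = card (T \<inter> {1..x})"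
      unfolding T_def Int_Un_distrib2
      by (rule card_Un_disjoint[symmetric]) (auto simp: E_def)
    finally show ?thesis by simp
  qed
  then have growth: "\<exists>c'. linear_growth c' T"
    using linear_growth_of_card_le[OF B(2) K] by blast
  have "K * card (partners R T \<inter> {1..x}) \<le> x" for x
  proof (cases "partners R T \<inter> {1..x} = {}")
    case False
    define m where "m = Max (partners R T \<inter> {1..x})"
    have m: "m \<in> partners R T \<inter> {1..x}"
      unfolding m_def using False by (intro Max_in) auto
    then obtain n where n: "n \<in> T" "R m n" unfolding partners_def by auto
    \<comment> \<open>\<open>R\<close> preserves order, so the mates of partners up to
      \<open>m\<close> lie up to \<open>n\<close>; having a positive partner they are in
      \<open>D\<close>, and the only elements of \<open>D\<close> left in \<open>T\<close> are those
      of \<open>E\<close>.\<close>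
    have "\<exists>n'. n' \<in> E \<inter> {1..n} \<and> R m' n'" if "m' \<in> partners R T \<inter> {1..x}" for m'
    proof -
      obtain n' where n': "n' \<in> T" "R m' n'"
        using \<open>m' \<in> partners R T \<inter> {1..x}\<close> unfolding partners_def by auto
      have "n' \<in> D" using n' TB that unfolding D_def by auto
      then have "n' \<in> E" using n' unfolding T_def by auto
      moreover have "m' \<le> m" unfolding m_def using that by (intro Max_ge) auto
      then have "n' \<le> n" using comonotone_less_iff[OF R n(2) n'(2)] by simp
      ultimately show ?thesis using n' TB B(1) by auto
    qed
    then obtain g where g: "\<And>m'. m' \<in> partners R T \<inter> {1..x} \<Longrightarrow> g m' \<in> E \<inter> {1..n} \<and> R m' (g m')"
      by metis
    have "card (partners R T \<inter> {1..x}) \<le> card (E \<inter> {1..n})"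
    proof (rule card_inj_on_le)
      show "inj_on g (partners R T \<inter> {1..x})"
        using g comonotone_eq_iff[OF R] by (meson inj_onI)
    qed (use g in auto)
    then have "K * card (partners R T \<inter> {1..x}) \<le> card (D \<inter> {1..n})"
      using E[of n] K by (metis less_eq_div_iff_mult_less_eq mult.commute)
    also have "card (D \<inter> {1..n}) \<le> card {1..x}"
    proof -
      \<comment> \<open>Conversely, the positive partner of an element of \<open>D\<close> up to
        \<open>n\<close> is at most \<open>m\<close>, hence at most \<open>x\<close>.\<close>
      have "\<exists>m'. m' \<in> {1..x} \<and> R m' n'" if "n' \<in> D \<inter> {1..n}" for n'
      proof -
        obtain m' where m': "m' \<ge> 1" "R m' n'" using \<open>n' \<in> D \<inter> {1..n}\<close> unfolding D_def by auto
        have "m' \<le> m" using comonotone_less_iff[OF R n(2) m'(2)] that by auto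
        then show ?thesis using m m' by auto
      qed
      then obtain h where h: "\<And>n'. n' \<in> D \<inter> {1..n} \<Longrightarrow> h n' \<in> {1..x} \<and> R (h n') n'"
        by metis
      show ?thesis
      proof (rule card_inj_on_le)
        show "inj_on h (D \<inter> {1..n})"
          using h comonotone_eq_iff[OF R] by (meson inj_onI)
      qed (use h in auto)
    qed
    finally show ?thesis by simp
  qed simp
  then show ?thesis using TB growth by blast
qed

text \<open>The relations are treated one after the other: passing to a subset only shrinks the
  partners, so bounds already obtained survive.\<close>

lemma thin_finite_comonotone:
  assumes "finite Q" "\<forall>R\<in>Q. comonotone R" "K > 0"
    and B: "B \<subseteq> {1..}" "\<exists>c. linear_growth c B"
  shows "\<exists>T\<subseteq>B. (\<exists>c. linear_growth c T) \<and>
    (\<forall>R\<in>Q. \<forall>x. K * card (partners R T \<inter> {1..x}) \<le> x)"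
  using assms(1,2)
proof (induction Q rule: finite_induct)
  case empty
  then show ?case using B by blast
next
  case (insert R Q)
  then obtain S c where S: "S \<subseteq> B" "linear_growth c S"
    and SQ: "\<forall>R\<in>Q. \<forall>x. K * card (partners R S \<inter> {1..x}) \<le> x" by auto
  obtain T where T: "T \<subseteq> S" "\<exists>c'. linear_growth c' T"
    and TR: "\<forall>x. K * card (partners R T \<inter> {1..x}) \<le> x"
    using thin_comonotone[of R K S c] insert.prems assms(3) S B(1) by auto
  have "K * card (partners R' T \<inter> {1..x}) \<le> x" if "R' \<in> Q" for R' x
  proof -
    have "card (partners R' T \<inter> {1..x}) \<le> card (partners R' S \<inter> {1..x})"
      using partners_mono[OF T(1), of R'] by (intro card_mono) auto
    then show ?thesis using SQ that by (meson le_trans mult_le_mono2)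
  qed
  then show ?case using S T TR by (intro exI[of _ T]) auto
qed

text \<open>A union bound with \<open>K > card Q / \<epsilon>\<close>. Validity at every
  \<open>x\<close> matters: such bounds will be summed over infinitely many levels, where thresholds
  need not be uniform.\<close>

lemma thin_partners_density:
  assumes Q: "finite Q" "\<forall>R\<in>Q. comonotone R" and "\<epsilon> > 0"
    and B: "B \<subseteq> {1..}" "\<exists>c. linear_growth c B"
  shows "\<exists>T\<subseteq>B. (\<exists>c. linear_growth c T) \<and>
    (\<forall>x. real (card ((\<Union>R\<in>Q. partners R T) \<inter> {1..x})) \<le> \<epsilon> * real x)"
proof -
  obtain K :: nat where K: "real (card Q) / \<epsilon> < real K"
    using reals_Archimedean2 by blast
  have Kpos: "K > 0" using K \<open>\<epsilon> > 0\<close>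
    by (metis divide_nonneg_pos gr0I of_nat_0 of_nat_0_le_iff not_less)
  obtain T where T: "T \<subseteq> B" "\<exists>c. linear_growth c T"
    and TQ: "\<forall>R\<in>Q. \<forall>x. K * card (partners R T \<inter> {1..x}) \<le> x"
    using thin_finite_comonotone[OF Q Kpos B] by blast
  have "real (card ((\<Union>R\<in>Q. partners R T) \<inter> {1..x})) \<le> \<epsilon> * real x" for x
  proof -
    have "card ((\<Union>R\<in>Q. partners R T) \<inter> {1..x}) = card (\<Union>R\<in>Q. partners R T \<inter> {1..x})"
      by (simp add: Int_UN_distrib2)
    also have "\<dots> \<le> (\<Sum>R\<in>Q. card (partners R T \<inter> {1..x}))"
      by (rule card_UN_le[OF Q(1)])
    finally have "K * card ((\<Union>R\<in>Q. partners R T) \<inter> {1..x}) \<le> K * (\<Sum>R\<in>Q. card (partners R T \<inter> {1..x}))"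
      by simp
    also have "\<dots> = (\<Sum>R\<in>Q. K * card (partners R T \<inter> {1..x}))"
      by (rule sum_distrib_left)
    also have "\<dots> \<le> card Q * x"
      using TQ sum_bounded_above[of Q "\<lambda>R. K * card (partners R T \<inter> {1..x})" x] by simp
    finally have "real K * real (card ((\<Union>R\<in>Q. partners R T) \<inter> {1..x})) \<le> real (card Q) * real x"
      by (metis of_nat_le_iff of_nat_mult)
    also have "\<dots> \<le> real K * (\<epsilon> * real x)"
    proof -
      have "real (card Q) \<le> real K * \<epsilon>" using K \<open>\<epsilon> > 0\<close> by (simp add: field_simps)
      then show ?thesis by (metis mult.assoc mult_right_mono of_nat_0_le_iff)
    qed
    finally show ?thesis using Kpos by simp
  qed
  then show ?thesis using T by blast
qed

section \<open>Conflict-free selections\<close>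

text \<open>Going through \<open>B\<close> in increasing order, a rejected number is a neighbour of
  a smaller selected one, and each selected number rejects at most \<open>d\<close> others. So about
  a share \<open>1 / (d + 1)\<close> of \<open>B\<close> survives.\<close>

lemma greedy_independent_subset:
  fixes E :: "nat \<Rightarrow> nat \<Rightarrow> bool"
  assumes deg: "\<And>n. finite {m. E n m}" "\<And>n. card {m. E n m} \<le> d"
    and B: "linear_growth c B"
  shows "\<exists>A\<subseteq>B. (\<exists>c'. linear_growth c' A) \<and> (\<forall>n\<in>A. \<forall>m\<in>A. n < m \<longrightarrow> \<not> E n m)"
proof -
  \<comment> \<open>\<open>g m\<close> is the selection made among the numbers below
    \<open>m\<close>.\<close>
  define g where "g = rec_nat ({} :: nat set)
    (\<lambda>m S. if m \<in> B \<and> (\<forall>n\<in>S. \<not> E n m) then insert m S else S)"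
  have g0: "g 0 = {}"
    and gSuc: "g (Suc m) = (if m \<in> B \<and> (\<forall>n\<in>g m. \<not> E n m) then insert m (g m) else g m)" for m
    unfolding g_def by auto
  define A where "A = (\<Union>m. g m)"
  have lt: "n < m" if "n \<in> g m" for n m
    using that by (induction m) (auto simp: g0 gSuc less_Suc_eq split: if_splits)
  have "g m \<subseteq> B" for m
    by (induction m) (auto simp: g0 gSuc)
  then have AB: "A \<subseteq> B" unfolding A_def by auto
  have stable: "n \<in> g (Suc n)" if "n \<in> g m" for n m
    using that by (induction m) (auto simp: g0 gSuc split: if_splits)
  have "g m \<subseteq> g (Suc m)" for m by (auto simp: gSuc)
  then have ext: "n \<in> g m" if "n \<in> g (Suc n)" "n < m" for n m
    using lift_Suc_mono_le[of g "Suc n" m] that by (meson Suc_leI subsetD)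
  have mem: "n \<in> g m \<longleftrightarrow> n \<in> A \<and> n < m" for n m
    unfolding A_def using lt stable ext by blast
  have "\<not> E n m" if "n \<in> A" "m \<in> A" "n < m" for n m
  proof -
    have "m \<in> g (Suc m)" "m \<notin> g m" "n \<in> g m" using that mem by auto
    then show ?thesis by (auto simp: gSuc split: if_splits)
  qed
  moreover have "\<exists>c'. linear_growth c' A"
  proof (rule linear_growth_of_card_le[OF B])
    fix x
    \<comment> \<open>\<open>0\<close> may be selected and reject positive numbers, although no
      window \<open>{1..x}\<close> counts it; it accounts for the additive \<open>Suc d\<close>
      below.\<close>
    let ?S = "A \<inter> {1..x} \<union> (A \<inter> {0})"
    have "B \<inter> {1..x} \<subseteq> ?S \<union> (\<Union>n\<in>?S. {m. E n m})"
    proof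
      fix m assume m: "m \<in> B \<inter> {1..x}"
      show "m \<in> ?S \<union> (\<Union>n\<in>?S. {m. E n m})"
      proof (cases "m \<in> A")
        case False
        then have "m \<notin> g (Suc m)" using mem by auto
        then obtain n where "n \<in> g m" "E n m" using m by (auto simp: gSuc split: if_splits)
        then show ?thesis using m mem by fastforce
      qed (use m in auto)
    qed
    then have "card (B \<inter> {1..x}) \<le> card (?S \<union> (\<Union>n\<in>?S. {m. E n m}))"
      using deg(1) by (intro card_mono) auto
    also have "\<dots> \<le> card ?S + card (\<Union>n\<in>?S. {m. E n m})"
      by (rule card_Un_le)
    also have "card (\<Union>n\<in>?S. {m. E n m}) \<le> (\<Sum>n\<in>?S. card {m. E n m})"
      by (rule card_UN_le) auto
    also have "\<dots> \<le> card ?S * d"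
      using sum_bounded_above[of ?S "\<lambda>n. card {m. E n m}" d] deg(2) by simp
    also have "card ?S + card ?S * d = Suc d * card ?S" by simp
    also have "\<dots> \<le> Suc d * (card (A \<inter> {1..x}) + 1)"
    proof (rule mult_le_mono2)
      have "card (A \<inter> {0}) \<le> card {0::nat}" by (rule card_mono) auto
      then show "card ?S \<le> card (A \<inter> {1..x}) + 1"
        using card_Un_le[of "A \<inter> {1..x}" "A \<inter> {0}"] by simp
    qed
    finally show "card (B \<inter> {1..x}) \<le> Suc d * card (A \<inter> {1..x}) + Suc d"
      by (simp add: algebra_simps)
  qed simp
  ultimately show ?thesis using AB by blast
qed

lemma finite_card_at_most_one:
  assumes "\<And>m m'. P m \<Longrightarrow> P m' \<Longrightarrow> m = m'"
  shows "finite {m. P m}" "card {m. P m} \<le> 1"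
proof -
  have "{m. P m} = {} \<or> (\<exists>a. {m. P m} = {a})" using assms by blast
  then show "finite {m. P m}" "card {m. P m} \<le> 1" by auto
qed

text \<open>Each relation gives a number at most one neighbour in either direction, so degrees are
  at most \<open>card Q * 2\<close>. \<open>E\<close> is symmetric so that the ordered conclusion of
  the greedy choice excludes both orders.\<close>

lemma comonotone_free_subset:
  assumes Q: "finite Q" "\<forall>R\<in>Q. comonotone R" and B: "linear_growth c B"
  shows "\<exists>A\<subseteq>B. (\<exists>c'. linear_growth c' A) \<and>
    (\<forall>R\<in>Q. \<forall>m\<in>A. \<forall>n\<in>A. m \<noteq> n \<longrightarrow> \<not> R m n)"
proof -
  define E where "E n m \<longleftrightarrow> (\<exists>R\<in>Q. R n m \<or> R m n)" for n m
  have eq: "{m. E n m} = (\<Union>R\<in>Q. {m. R n m} \<union> {m. R m n})" for n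
    unfolding E_def by auto
  have fin: "finite {m. R n m}" "card {m. R n m} \<le> 1"
    "finite {m. R m n}" "card {m. R m n} \<le> 1" if "R \<in> Q" for R n
    using finite_card_at_most_one[of "\<lambda>m. R n m"] finite_card_at_most_one[of "\<lambda>m. R m n"]
      comonotone_eq_iff[of R] Q(2) that by blast+
  have deg_fin: "finite {m. E n m}" for n
    unfolding eq using Q(1) fin by auto
  have deg: "card {m. E n m} \<le> card Q * 2" for n
  proof -
    have "card {m. E n m} \<le> (\<Sum>R\<in>Q. card ({m. R n m} \<union> {m. R m n}))"
      unfolding eq by (rule card_UN_le[OF Q(1)])
    also have "\<dots> \<le> of_nat (card Q) * 2"
    proof (rule sum_bounded_above)
      fix R assume "R \<in> Q"
      then show "card ({m. R n m} \<union> {m. R m n}) \<le> 2"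
        using fin[of R n] card_Un_le[of "{m. R n m}" "{m. R m n}"] by linarith
    qed
    finally show ?thesis by simp
  qed
  obtain A where A: "A \<subseteq> B" "\<exists>c'. linear_growth c' A"
    "\<forall>n\<in>A. \<forall>m\<in>A. n < m \<longrightarrow> \<not> E n m"
    using greedy_independent_subset[of E, OF deg_fin deg B] by blast
  have "\<not> R m n" if "R \<in> Q" "m \<in> A" "n \<in> A" "m \<noteq> n" for R m n
    using A(3) that unfolding E_def by (metis nat_neq_iff)
  then show ?thesis using A by blast
qed

text \<open>The sets \<open>C l\<close> are chosen in increasing order of \<open>l\<close>, each
  with few partners relative to the earlier growth constants. Every \<open>C i\<close> then loses at
  most half of its constant to the later levels.\<close>

lemma conflict_free_sequence:
  fixes B :: "nat \<Rightarrow> nat set" and Q :: "nat \<Rightarrow> (nat \<Rightarrow> nat \<Rightarrow> bool) set"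
  assumes Q: "\<And>l. finite (Q l)" "\<And>l. \<forall>R\<in>Q l. comonotone R"
    and B: "\<And>l. B l \<in> pos_lower_density_sets"
  shows "\<exists>A. (\<forall>l. A l \<in> pos_lower_density_sets \<and> A l \<subseteq> B l) \<and>
    (\<forall>i l. i \<le> l \<longrightarrow> (\<forall>R\<in>Q l. \<forall>m\<in>A i. \<forall>n\<in>A l. m \<noteq> n \<longrightarrow> \<not> R m n))"
proof -
  define N where "N l C = (\<Union>R\<in>Q l. partners R C)" for l C
  have thin: "\<exists>T\<subseteq>B l. (\<exists>c. linear_growth c T) \<and>
      (\<forall>x. real (card (N l T \<inter> {1..x})) \<le> \<epsilon> * real x)" if "\<epsilon> > 0" for l \<epsilon>
    unfolding N_def
    by (rule thin_partners_density[OF Q that]) (use B[of l] pos_lower_density_iff in auto)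
  \<comment> \<open>The state is a set with its growth constant. Halving bounds the sum of the
    constants from any level on by twice the first; with the factor \<open>1 / 4\<close>, the
    partners of all later levels cost at most half of \<open>snd z\<close>.\<close>
  have "\<exists>y. (fst y \<subseteq> B (Suc l) \<and> linear_growth (snd y) (fst y)) \<and>
      snd y \<le> snd z / 2 \<and> (\<forall>x. real (card (N (Suc l) (fst y) \<inter> {1..x})) \<le> snd z / 4 * real x)"
    if "fst z \<subseteq> B l \<and> linear_growth (snd z) (fst z)" for z l
  proof -
    have z: "snd z > 0" using that unfolding linear_growth_def by simp
    obtain T c where T: "T \<subseteq> B (Suc l)" "linear_growth c T"
      "\<forall>x. real (card (N (Suc l) T \<inter> {1..x})) \<le> snd z / 4 * real x"
      using thin[of "snd z / 4" "Suc l"] z by auto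
    have "c > 0" using T(2) unfolding linear_growth_def by simp
    \<comment> \<open>A growth constant may be lowered at will, which enforces the halving.\<close>
    then have "linear_growth (min c (snd z / 2)) T"
      using linear_growth_mono[OF T(2)] z by simp
    then show ?thesis using T by (intro exI[of _ "(T, min c (snd z / 2))"]) simp
  qed
  moreover have "\<exists>z. fst z \<subseteq> B 0 \<and> linear_growth (snd z) (fst z)"
    using B[of 0] pos_lower_density_iff by auto
  ultimately obtain z :: "nat \<Rightarrow> nat set \<times> real" where
    z: "\<And>l. fst (z l) \<subseteq> B l \<and> linear_growth (snd (z l)) (fst (z l))" and
    step: "\<And>l. snd (z (Suc l)) \<le> snd (z l) / 2 \<and>
      (\<forall>x. real (card (N (Suc l) (fst (z (Suc l))) \<inter> {1..x})) \<le> snd (z l) / 4 * real x)"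
    using dependent_nat_choice[of "\<lambda>l z. fst z \<subseteq> B l \<and> linear_growth (snd z) (fst z)"
      "\<lambda>l z y. snd y \<le> snd z / 2 \<and>
        (\<forall>x. real (card (N (Suc l) (fst y) \<inter> {1..x})) \<le> snd z / 4 * real x)"] by metis
  define C where "C l = fst (z l)" for l
  define e where "e l = snd (z l)" for l
  have C: "C l \<subseteq> B l" "linear_growth (e l) (C l)" and e_half: "e (Suc l) \<le> e l / 2"
    and NC: "real (card (N (Suc l) (C (Suc l)) \<inter> {1..x})) \<le> e l / 4 * real x" for l x
    unfolding C_def e_def using z step by auto
  have e_pos: "e l > 0" for l using C(2) unfolding linear_growth_def by blast
  define M where "M i = (\<Union>k. N (Suc (i + k)) (C (Suc (i + k))))" for i
  \<comment> \<open>The subtracted term makes the geometric bound inductive; it is dropped when the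
    bound is applied.\<close>
  have e_sum: "(\<Sum>k<L. e (i + k)) \<le> 2 * e i - 2 * e (i + L)" for i L
  proof (induction L)
    case (Suc L)
    then show ?case using e_half[of "i + L"] by simp
  qed simp
  have "real (card (M i \<inter> {1..x})) \<le> e i / 2 * real x" for i x
  proof -
    let ?F = "\<lambda>k. N (Suc (i + k)) (C (Suc (i + k))) \<inter> {1..x}"
    \<comment> \<open>The window is finite, so finitely many levels already cover \<open>M i\<close>
      inside it and a finite union bound suffices.\<close>
    have "\<exists>k. m \<in> ?F k" if "m \<in> M i \<inter> {1..x}" for m
      using that unfolding M_def by auto
    then obtain h where h: "\<And>m. m \<in> M i \<inter> {1..x} \<Longrightarrow> m \<in> ?F (h m)" by metis
    obtain L where L: "\<forall>k\<in>h ` (M i \<inter> {1..x}). k < L"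
      using finite_nat_set_iff_bounded by blast
    have "M i \<inter> {1..x} \<subseteq> (\<Union>k<L. ?F k)" using h L by blast
    then have "card (M i \<inter> {1..x}) \<le> card (\<Union>k<L. ?F k)"
      by (intro card_mono) auto
    also have "\<dots> \<le> (\<Sum>k<L. card (?F k))"
      by (rule card_UN_le) auto
    finally have "real (card (M i \<inter> {1..x})) \<le> (\<Sum>k<L. real (card (?F k)))"
      by (metis of_nat_le_iff of_nat_sum)
    also have "\<dots> \<le> (\<Sum>k<L. e (i + k) / 4 * real x)"
      by (intro sum_mono NC)
    also have "\<dots> = (\<Sum>k<L. e (i + k)) * (real x / 4)"
      by (simp add: sum_distrib_right)
    also have "\<dots> \<le> (2 * e i) * (real x / 4)"
      using e_sum[where i = i and L = L] e_pos[of "i + L"] by (intro mult_right_mono) auto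
    finally show ?thesis by (simp add: mult.commute)
  qed
  then have "linear_growth (e i / 2) (C i - M i)" for i
    using linear_growth_Diff[OF C(2)] by blast
  \<comment> \<open>Conflicts within a level are removed last; shrinking the sets creates no new
    conflicts between levels.\<close>
  then have "\<exists>A\<subseteq>C i - M i. (\<exists>c'. linear_growth c' A) \<and>
    (\<forall>R\<in>Q i. \<forall>m\<in>A. \<forall>n\<in>A. m \<noteq> n \<longrightarrow> \<not> R m n)" for i
    by (rule comonotone_free_subset[OF Q])
  then obtain A where A: "\<And>i. A i \<subseteq> C i - M i" "\<And>i. \<exists>c'. linear_growth c' (A i)"
    and self: "\<And>i. \<forall>R\<in>Q i. \<forall>m\<in>A i. \<forall>n\<in>A i. m \<noteq> n \<longrightarrow> \<not> R m n"
    by metis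
  have AB: "A l \<subseteq> B l" for l using A(1) C(1) by blast
  then have "A l \<in> pos_lower_density_sets" for l
    using A(2) B[of l] unfolding pos_lower_density_iff by blast
  moreover have "\<not> R m n"
    if "i \<le> l" "R \<in> Q l" "m \<in> A i" "n \<in> A l" "m \<noteq> n" for i l R m n
  proof (cases "i = l")
    case False
    then obtain k where k: "l = Suc (i + k)" using \<open>i \<le> l\<close> less_imp_Suc_add le_neq_implies_less by blast
    show ?thesis
    proof
      assume "R m n"
      then have "m \<in> N l (C l)" using that A(1)[of l] unfolding N_def partners_def by auto
      then have "m \<in> M i" unfolding M_def k by blast
      then show False using that A(1)[of i] by auto
    qed
  qed (use that self in auto)
  ultimately show ?thesis using AB by blast
qed

section \<open>Orbits\<close>

text \<open>Strictly increasing integer values gain at least one per step, so \<open>g x > x\<close>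
  spreads from \<open>1\<close> to all positive \<open>x\<close>, and orbits started there stay
  positive.\<close>

lemma strict_mono_orbit:
  fixes g :: "nat \<Rightarrow> nat"
  assumes g: "strict_mono_on {1..} g" "g 1 > 1" and a: "a \<ge> 1"
  shows "strict_mono (\<lambda>m. (g ^^ m) a)"
proof -
  have gt: "g x > x" if "x \<ge> 1" for x
    using that
  proof (induction x rule: nat_induct_at_least)
    case (Suc x)
    then have "g x < g (Suc x)" by (intro strict_mono_onD[OF g(1)]) auto
    then show ?case using Suc by simp
  qed (use g in simp)
  have ge: "(g ^^ m) a \<ge> 1" for m
    by (induction m) (use a gt in \<open>auto intro: less_imp_le le_less_trans\<close>)
  show ?thesis
    unfolding strict_mono_Suc_iff using gt[OF ge] by simp
qed

theorem theorem3p4: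
  fixes N :: nat and f :: "nat \<Rightarrow> nat \<Rightarrow> nat"
  assumes "\<And>s. s \<in> {1..N} \<Longrightarrow> f s ` {1..} \<subseteq> {1..}"
    and "\<And>s. s \<in> {1..N} \<Longrightarrow> strict_mono_on {1..} (f s)"
    and "\<And>s. s \<in> {1..N} \<Longrightarrow> f s 1 > 1"
  shows "weakly_partition_regular N f pos_lower_density_sets"
  unfolding weakly_partition_regular_def
proof (intro allI impI)
  fix B :: "nat \<Rightarrow> nat set"
  assume B: "\<forall>j\<ge>1. B j \<in> pos_lower_density_sets"
  \<comment> \<open>Level \<open>l\<close> stands for the index \<open>Suc l\<close> of the theorem.
    Both starting points range up to \<open>Suc l\<close>, which covers the smaller range of every
    level \<open>i \<le> l\<close>.\<close>
  define Q where "Q l = (\<lambda>(s, t, a, b) m n. (f s ^^ m) a = (f t ^^ n) b) `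
    ({1..N} \<times> {1..N} \<times> {1..Suc l} \<times> {1..Suc l})" for l
  have "comonotone R" if R: "R \<in> Q l" for R l
  proof -
    obtain s t a b where st: "s \<in> {1..N}" "t \<in> {1..N}" "a \<ge> 1" "b \<ge> 1"
      and R: "R = (\<lambda>m n. (f s ^^ m) a = (f t ^^ n) b)"
      using R unfolding Q_def by auto
    have "strict_mono (\<lambda>m. (f s ^^ m) a)" "strict_mono (\<lambda>n. (f t ^^ n) b)"
      using strict_mono_orbit assms(2,3) st by blast+
    then show ?thesis unfolding comonotone_def R by (metis strict_mono_less)
  qed
  moreover have "finite (Q l)" for l unfolding Q_def by simp
  ultimately obtain A where A: "\<And>l. A l \<in> pos_lower_density_sets \<and> A l \<subseteq> B (Suc l)"
    and free: "\<And>i l R m n. \<lbrakk>i \<le> l; R \<in> Q l; m \<in> A i; n \<in> A l; m \<noteq> n\<rbrakk> \<Longrightarrow> \<not> R m n"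
    using conflict_free_sequence[of Q "\<lambda>l. B (Suc l)"] B by (metis le_add1 plus_1_eq_Suc)
  have ne: "(f s ^^ m) a \<noteq> (f t ^^ n) b"
    if "i \<le> l" "m \<in> A i" "n \<in> A l" "m \<noteq> n" "s \<in> {1..N}" "t \<in> {1..N}"
      "a \<in> {1..Suc i}" "b \<in> {1..Suc l}" for i l m n s t a b
  proof -
    have "(s, t, a, b) \<in> {1..N} \<times> {1..N} \<times> {1..Suc l} \<times> {1..Suc l}" using that by auto
    then have "(\<lambda>m n. (f s ^^ m) a = (f t ^^ n) b) \<in> Q l"
      unfolding Q_def by (rule image_eqI[rotated]) simp
    from free[OF that(1) this that(2,3,4)] show ?thesis .
  qed
  have disj: "(f s ^^ m) ` {1..Suc i} \<inter> (f t ^^ n) ` {1..Suc l} = {}"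
    if "m \<in> A i" "n \<in> A l" "m \<noteq> n" "s \<in> {1..N}" "t \<in> {1..N}" for i l m n s t
  proof (cases "i \<le> l")
    case True
    then show ?thesis using ne that by blast
  next
    case False
    \<comment> \<open>All ordered pairs of maps occur in \<open>ne\<close>, so
      \<open>(i, m, s)\<close> and \<open>(l, n, t)\<close> may exchange roles.\<close>
    then have "l \<le> i" by simp
    then show ?thesis using ne[of l i n m t s] that by fastforce
  qed
  show "\<exists>A. (\<forall>j\<ge>1. A j \<in> pos_lower_density_sets) \<and>
      (\<forall>j\<ge>1. \<forall>l\<ge>1. A j \<subseteq> B j \<and>
        (\<forall>m\<in>A j. \<forall>n\<in>A l. m \<noteq> n \<longrightarrow>
          (\<forall>s\<in>{1..N}. \<forall>t\<in>{1..N}. (f s ^^ m) ` {1..j} \<inter> (f t ^^ n) ` {1..l} = {})))"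
  proof (intro exI[of _ "\<lambda>j. A (j - 1)"] conjI allI impI ballI)
    fix j :: nat assume "1 \<le> j"
    then show "A (j - 1) \<subseteq> B j" using A[of "j - 1"] by simp
  next
    fix j l m n s t :: nat
    assume "1 \<le> j" "1 \<le> l" "m \<in> A (j - 1)" "n \<in> A (l - 1)" "m \<noteq> n" "s \<in> {1..N}" "t \<in> {1..N}"
    then show "(f s ^^ m) ` {1..j} \<inter> (f t ^^ n) ` {1..l} = {}"
      using disj[of m "j - 1" n "l - 1" s t] by simp
  qed (use A in blast)
qed

end
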